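(* Let $L>0$ and let $f:\mathbb{R}^n\to\mathbb{R}$ be convex and $L$-smooth, attaining its minimum value $\min f$. Assume that $f$ satisfies the Polyak-Łojasiewicz inequality for some $\eta>0$: $$\frac12\|\nabla f(x)\|^2\ge \eta\,(f(x)-\min f)\qquad\text{for all }x\in\mathbb{R}^n.$$ Let $0<t\le\frac1L$, let $x\in\mathbb{R}^n$, and let $x^+=x-t\nabla f(x)$. Then $$f(x^+)-\min f\le \frac{1-\eta t}{1+\eta t}\,(f(x)-\min f).$$
   Context: $\mathbb{R}^n$ is Euclidean space with induced norm $\|\cdot\|$. A differentiable function $f:\mathbb{R}^n\to\mathbb{R}$ is $L$-smooth if $\|\nabla f(x)-\nabla f(y)\|\le L\|x-y\|$ for all $x,y\in\mathbb{R}^n$. *)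

theory Defs
  imports "HOL-Analysis.Analysis"
begin

text \<open>The value is only meaningful at points where \<open>f\<close> is differentiable.\<close>
definition gradient :: "('a::euclidean_space \<Rightarrow> real) \<Rightarrow> 'a \<Rightarrow> 'a" ("\<nabla>") where
  "\<nabla> f x = (THE D. GDERIV f x :> D)"

definition L_smooth :: "real \<Rightarrow> ('a::euclidean_space \<Rightarrow> real) \<Rightarrow> bool" where
  "L_smooth L f \<longleftrightarrow>
     (\<forall>x. f differentiable (at x)) \<and>
     (\<forall>x y. norm (\<nabla> f x - \<nabla> f y) \<le> L * norm (x - y))"

lemma gradient_eqI:
  assumes "GDERIV f x :> D"
  shows "\<nabla> f x = D"
proof -
  have "E = D" if "GDERIV f x :> E" for E
  proof -
    have "(\<lambda>h. h \<bullet> E) = (\<lambda>h. h \<bullet> D)"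
      using that assms unfolding gderiv_def by (rule has_derivative_unique)
    then show ?thesis
      using vector_eq_ldot[of E D] by (simp add: fun_eq_iff)
  qed
  with assms show ?thesis
    unfolding gradient_def by (rule the_equality)
qed

lemma differentiable_imp_GDERIV:
  fixes f :: "'a::euclidean_space \<Rightarrow> real"
  assumes "f differentiable (at x)"
  shows "GDERIV f x :> \<nabla> f x"
proof -
  obtain f' where f': "(f has_derivative f') (at x)"
    using assms by (auto simp: differentiable_def)
  then have lin: "linear f'"
    by (rule has_derivative_linear)
  define D where "D = (\<Sum>b\<in>Basis. f' b *\<^sub>R b)"
  have "f' h = h \<bullet> D" for h
  proof -
    have "f' h = f' (\<Sum>b\<in>Basis. (h \<bullet> b) *\<^sub>R b)"
      by (simp add: euclidean_representation)
    also have "\<dots> = (\<Sum>b\<in>Basis. (h \<bullet> b) * f' b)"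
      by (simp add: linear_sum[OF lin] linear_scale[OF lin])
    also have "\<dots> = h \<bullet> D"
      by (simp add: D_def inner_sum_right mult.commute)
    finally show ?thesis .
  qed
  then have "f' = (\<lambda>h. h \<bullet> D)"
    by (rule ext)
  with f' have "GDERIV f x :> D"
    by (simp add: gderiv_def)
  then show ?thesis
    by (simp only: gradient_eqI)
qed

end

theory Submission
  imports Defs
begin

text \<open>
  Write \<open>g\<close> and \<open>g\<^sub>+\<close> for the gradients at \<open>x\<close> and at \<open>x\<^sub>+ = x - t g\<close>. A convex \<open>L\<close>-smooth
  function lies above its tangent planes by at least \<open>1 / (2 L)\<close> times the squared change of
  gradient (\<open>convex_L_smooth_interpolation\<close>). Using the tangent plane at \<open>x\<^sub>+\<close>, evaluated
  at \<open>x\<close>, and \<open>t \<le> 1 / L\<close>, this gives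
  \<open>f x \<ge> f x\<^sub>+ + t (g\<^sub>+ \<bullet> g) + (t / 2) \<parallel>g - g\<^sub>+\<parallel>\<^sup>2\<close>,
  in which the mixed terms cancel: one step decreases \<open>f\<close> by at least
  \<open>(t / 2) (\<parallel>g\<parallel>\<^sup>2 + \<parallel>g\<^sub>+\<parallel>\<^sup>2)\<close> (\<open>gradient_step_decrease\<close>). The usual descent estimate controls
  the decrease by the gradient at \<open>x\<close> only; here the gradients at both endpoints
  contribute. Bounding both by the Polyak-Lojasiewicz inequality, and writing \<open>F\<close>, \<open>F\<^sub>+\<close> for
  the gaps to the minimum, yields \<open>F - F\<^sub>+ \<ge> \<eta> t (F + F\<^sub>+)\<close>, which is the claimed rate.
\<close>

lemma GDERIV_DERIV_along_line:
  assumes "GDERIV f (x + s *\<^sub>R h) :> D"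
  shows "((\<lambda>s. f (x + s *\<^sub>R h)) has_real_derivative (h \<bullet> D)) (at s)"
proof -
  have "((\<lambda>s. x + s *\<^sub>R h) has_derivative (\<lambda>u. u *\<^sub>R h)) (at s)"
    by (auto intro!: derivative_eq_intros)
  then have "((\<lambda>s. f (x + s *\<^sub>R h)) has_derivative (\<lambda>u. (u *\<^sub>R h) \<bullet> D)) (at s)"
    using assms unfolding gderiv_def by (rule has_derivative_compose)
  then show ?thesis
    by (simp add: has_field_derivative_def mult_commute_abs)
qed

lemma L_smooth_DERIV_along_line:
  assumes "L_smooth L f"
  shows "((\<lambda>s. f (x + s *\<^sub>R h)) has_real_derivative (h \<bullet> \<nabla> f (x + s *\<^sub>R h))) (at s)"
  using assms
  by (intro GDERIV_DERIV_along_line differentiable_imp_GDERIV) (simp add: L_smooth_def)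

text \<open>
  The Lipschitz bound makes the derivative of \<open>s \<mapsto> f (x + s h)\<close> exceed its value at \<open>0\<close> by at
  most \<open>L s \<parallel>h\<parallel>\<^sup>2\<close>. So the difference of \<open>f\<close> and the quadratic upper bound is
  nonincreasing along the segment from \<open>x\<close> to \<open>x + h\<close>.
\<close>
lemma L_smooth_quadratic_upper_bound:
  assumes smooth: "L_smooth L f"
  shows "f (x + h) \<le> f x + h \<bullet> \<nabla> f x + L / 2 * (norm h)\<^sup>2"
proof -
  define \<phi> where "\<phi> s = f (x + s *\<^sub>R h) - s * (h \<bullet> \<nabla> f x) - L / 2 * s\<^sup>2 * (norm h)\<^sup>2" for s
  have deriv: "(\<phi> has_real_derivative
      (h \<bullet> \<nabla> f (x + s *\<^sub>R h) - h \<bullet> \<nabla> f x - L * s * (norm h)\<^sup>2)) (at s)" for s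
    unfolding \<phi>_def
    by (auto intro!: derivative_eq_intros L_smooth_DERIV_along_line[OF smooth])
  have nonpos: "h \<bullet> \<nabla> f (x + s *\<^sub>R h) - h \<bullet> \<nabla> f x - L * s * (norm h)\<^sup>2 \<le> 0" if "0 \<le> s" for s
  proof -
    have "h \<bullet> \<nabla> f (x + s *\<^sub>R h) - h \<bullet> \<nabla> f x = h \<bullet> (\<nabla> f (x + s *\<^sub>R h) - \<nabla> f x)"
      by (simp add: inner_diff_right)
    also have "\<dots> \<le> norm h * norm (\<nabla> f (x + s *\<^sub>R h) - \<nabla> f x)"
      by (rule norm_cauchy_schwarz)
    also have "\<dots> \<le> norm h * (L * norm (x + s *\<^sub>R h - x))"
      using smooth unfolding L_smooth_def by (intro mult_left_mono) (blast, simp)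
    also have "\<dots> = L * s * (norm h)\<^sup>2"
      using that by (simp add: power2_eq_square)
    finally show ?thesis by simp
  qed
  have "\<phi> 1 \<le> \<phi> 0"
    by (rule DERIV_nonpos_imp_nonincreasing[of 0 1 \<phi>]) (simp, meson deriv nonpos)
  then show ?thesis by (simp add: \<phi>_def)
qed

lemma convex_on_line:
  assumes "convex_on UNIV f"
  shows "convex_on UNIV (\<lambda>s::real. f (x + s *\<^sub>R h))"
proof (rule convex_onI)
  fix u a b :: real
  assume "0 < u" "u < 1"
  have "x + ((1 - u) *\<^sub>R a + u *\<^sub>R b) *\<^sub>R h = (1 - u) *\<^sub>R (x + a *\<^sub>R h) + u *\<^sub>R (x + b *\<^sub>R h)"
    by (simp add: algebra_simps)
  then show "f (x + ((1 - u) *\<^sub>R a + u *\<^sub>R b) *\<^sub>R h)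
      \<le> (1 - u) * f (x + a *\<^sub>R h) + u * f (x + b *\<^sub>R h)"
    using convex_onD[OF assms, of u "x + a *\<^sub>R h" "x + b *\<^sub>R h"] \<open>0 < u\<close> \<open>u < 1\<close> by simp
qed simp

lemma convex_above_tangent_plane:
  assumes "convex_on UNIV f" and "GDERIV f x :> D"
  shows "f x + h \<bullet> D \<le> f (x + h)"
proof -
  have "((\<lambda>s. f (x + s *\<^sub>R h)) has_real_derivative (h \<bullet> D)) (at 0)"
    using assms(2) by (intro GDERIV_DERIV_along_line) simp
  then have "(h \<bullet> D) * (1 - 0) \<le> f (x + 1 *\<^sub>R h) - f (x + 0 *\<^sub>R h)"
    by (intro convex_on_imp_above_tangent[OF convex_on_line[OF assms(1)]]) auto
  then show ?thesis by simp
qed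

text \<open>
  Compare \<open>f\<close> at the point \<open>z = y - (1 / L) (\<nabla> f y - \<nabla> f x)\<close>, the minimizer of the quadratic
  upper bound at \<open>y\<close> minus the tangent plane at \<open>x\<close>: convexity puts \<open>f z\<close> above the tangent
  plane at \<open>x\<close>, smoothness puts it below the upper bound at \<open>y\<close>.
\<close>
lemma convex_L_smooth_interpolation:
  assumes L: "L > 0" and convex: "convex_on UNIV f" and smooth: "L_smooth L f"
  shows "f x + (y - x) \<bullet> \<nabla> f x + 1 / (2 * L) * (norm (\<nabla> f y - \<nabla> f x))\<^sup>2 \<le> f y"
proof -
  define d where "d = \<nabla> f y - \<nabla> f x"
  have "f x + (y - x - (1 / L) *\<^sub>R d) \<bullet> \<nabla> f x \<le> f (x + (y - x - (1 / L) *\<^sub>R d))"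
    using convex smooth
    by (intro convex_above_tangent_plane differentiable_imp_GDERIV) (auto simp: L_smooth_def)
  also have "x + (y - x - (1 / L) *\<^sub>R d) = y + - ((1 / L) *\<^sub>R d)"
    by simp
  also have "f \<dots> \<le> f y + - ((1 / L) *\<^sub>R d) \<bullet> \<nabla> f y + L / 2 * (norm (- ((1 / L) *\<^sub>R d)))\<^sup>2"
    by (rule L_smooth_quadratic_upper_bound[OF smooth])
  also have "L / 2 * (norm (- ((1 / L) *\<^sub>R d)))\<^sup>2 = 1 / (2 * L) * (norm d)\<^sup>2"
    using L by (simp add: power2_eq_square)
  finally have "f x + (y - x) \<bullet> \<nabla> f x + (1 / L) * (d \<bullet> \<nabla> f y - d \<bullet> \<nabla> f x)
      \<le> f y + 1 / (2 * L) * (norm d)\<^sup>2"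
    by (simp add: inner_diff_left algebra_simps)
  moreover have "d \<bullet> \<nabla> f y - d \<bullet> \<nabla> f x = (norm d)\<^sup>2"
    by (simp add: power2_norm_eq_inner d_def inner_diff_right)
  ultimately show ?thesis
    by (simp add: d_def)
qed

lemma gradient_step_decrease:
  fixes x :: "'a::euclidean_space"
  assumes L: "L > 0" and convex: "convex_on UNIV f" and smooth: "L_smooth L f"
    and t: "0 < t" "t \<le> 1 / L"
  defines "xp \<equiv> x - t *\<^sub>R \<nabla> f x"
  shows "f xp + t / 2 * ((norm (\<nabla> f x))\<^sup>2 + (norm (\<nabla> f xp))\<^sup>2) \<le> f x"
proof -
  have "t / 2 * (norm (\<nabla> f x - \<nabla> f xp))\<^sup>2 \<le> 1 / (2 * L) * (norm (\<nabla> f x - \<nabla> f xp))\<^sup>2"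
    using t by (intro mult_right_mono) auto
  then have "f xp + (x - xp) \<bullet> \<nabla> f xp + t / 2 * (norm (\<nabla> f x - \<nabla> f xp))\<^sup>2 \<le> f x"
    using convex_L_smooth_interpolation[OF L convex smooth, of xp x] by linarith
  moreover have "(x - xp) \<bullet> \<nabla> f xp = t * (\<nabla> f x \<bullet> \<nabla> f xp)"
    by (simp add: xp_def)
  moreover have "(norm (\<nabla> f x - \<nabla> f xp))\<^sup>2
      = (norm (\<nabla> f x))\<^sup>2 - 2 * (\<nabla> f x \<bullet> \<nabla> f xp) + (norm (\<nabla> f xp))\<^sup>2"
    by (simp add: power2_norm_eq_inner inner_diff inner_commute)
  ultimately show ?thesis
    by (simp add: algebra_simps)
qed

theorem corollary3p1:
  fixes f :: "real ^ 'n \<Rightarrow> real"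
    and L \<eta> t :: real
    and x xmin :: "real ^ 'n"
  assumes "L > 0"
    and "convex_on UNIV f"
    and "L_smooth L f"
    and "is_arg_min f (\<lambda>_. True) xmin"
    and "\<eta> > 0"
    and "\<And>y. 1 / 2 * (norm (\<nabla> f y))\<^sup>2 \<ge> \<eta> * (f y - f xmin)"
    and "0 < t" and "t \<le> 1 / L"
  shows "f (x - t *\<^sub>R \<nabla> f x) - f xmin \<le> (1 - \<eta> * t) / (1 + \<eta> * t) * (f x - f xmin)"
proof -
  define xp where "xp = x - t *\<^sub>R \<nabla> f x"
  have "f xp + t / 2 * ((norm (\<nabla> f x))\<^sup>2 + (norm (\<nabla> f xp))\<^sup>2) \<le> f x"
    unfolding xp_def using assms by (intro gradient_step_decrease)
  moreover have "t * (\<eta> * (f y - f xmin)) \<le> t * (1 / 2 * (norm (\<nabla> f y))\<^sup>2)" for y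
    using assms(6)[of y] \<open>0 < t\<close> by (intro mult_left_mono) auto
  from this[of x] this[of xp]
  have "\<eta> * t * (f x - f xmin) + \<eta> * t * (f xp - f xmin)
      \<le> t / 2 * ((norm (\<nabla> f x))\<^sup>2 + (norm (\<nabla> f xp))\<^sup>2)"
    by (simp add: algebra_simps)
  ultimately have "(1 + \<eta> * t) * (f xp - f xmin) \<le> (1 - \<eta> * t) * (f x - f xmin)"
    by (simp add: algebra_simps)
  moreover have "0 < 1 + \<eta> * t"
    using \<open>\<eta> > 0\<close> \<open>0 < t\<close> by (simp add: add_pos_pos)
  ultimately show ?thesis
    by (simp add: xp_def pos_le_divide_eq mult.commute)
qed

end
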